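(* Let $G$ be a simple game with $n$ players. Then $G$ is roughly weighted if and only if $G$ has the at-least-half property of degree $(n+1)2^{\frac{1}{2}n\log_2 n}$.
   Context: A simple game is $G=(P,W)$ with $P=[n]$, $W\subseteq 2^P$ (winning coalitions) closed under supersets within $P$, $W\ne\emptyset$, $W\ne 2^P$; other coalitions are losing. $G$ is roughly weighted if there exist non-negative reals $w_1,\dots,w_n$ and a real $q$, not all zero, such that $\sum_{i\in X}w_i<q$ implies $X$ losing and $\sum_{i\in X}w_i>q$ implies $X$ winning. A coalition is blocking if it is the complement of a losing coalition. A sequence of coalitions $(Z_1,\dots,Z_{2k})$ is an EL sequence of degree $k$ if half of its coalitions are winning and half are blocking. $G$ has the at-least-half property of degree $k$ if every EL sequence of degree $k$ or less has some player occurring in at least half of the coalitions of the sequence. *)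

theory Defs
  imports Complex_Main
begin

type_synonym coalition = "nat set"

definition players :: "nat \<Rightarrow> nat set" where
  "players n = {1..n}"

definition simple_game :: "nat \<Rightarrow> coalition set \<Rightarrow> bool" where
  "simple_game n W \<longleftrightarrow>
     W \<subseteq> Pow (players n) \<and>
     (\<forall>X Y. X \<in> W \<and> X \<subseteq> Y \<and> Y \<subseteq> players n \<longrightarrow> Y \<in> W) \<and>
     W \<noteq> {} \<and> W \<noteq> Pow (players n)"

definition winning :: "nat \<Rightarrow> coalition set \<Rightarrow> coalition \<Rightarrow> bool" where
  "winning n W X \<longleftrightarrow> X \<subseteq> players n \<and> X \<in> W"

definition losing :: "nat \<Rightarrow> coalition set \<Rightarrow> coalition \<Rightarrow> bool" where
  "losing n W X \<longleftrightarrow> X \<subseteq> players n \<and> X \<notin> W"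

definition blocking :: "nat \<Rightarrow> coalition set \<Rightarrow> coalition \<Rightarrow> bool" where
  "blocking n W Z \<longleftrightarrow> (\<exists>X. losing n W X \<and> Z = players n - X)"

definition roughly_weighted :: "nat \<Rightarrow> coalition set \<Rightarrow> bool" where
  "roughly_weighted n W \<longleftrightarrow>
     (\<exists>(w :: nat \<Rightarrow> real) (q :: real).
        (\<forall>i\<in>players n. 0 \<le> w i) \<and>
        \<not> ((\<forall>i\<in>players n. w i = 0) \<and> q = 0) \<and>
        (\<forall>X. X \<subseteq> players n \<longrightarrow>
           ((\<Sum>i\<in>X. w i) < q \<longrightarrow> losing n W X) \<and>
           ((\<Sum>i\<in>X. w i) > q \<longrightarrow> winning n W X)))"

text \<open>A coalition can be winning and blocking at the same time. ``Half winning and half blocking''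
  therefore means that the positions of the sequence split into two sets of size \<open>k\<close>,
  one carrying winning and the other carrying blocking coalitions. Repetitions are allowed.\<close>

definition EL_sequence :: "nat \<Rightarrow> coalition set \<Rightarrow> nat \<Rightarrow> coalition list \<Rightarrow> bool" where
  "EL_sequence n W k Zs \<longleftrightarrow>
     1 \<le> k \<and> length Zs = 2 * k \<and>
     (\<exists>I \<subseteq> {..<2 * k}. card I = k \<and>
        (\<forall>j\<in>I. winning n W (Zs ! j)) \<and>
        (\<forall>j\<in>{..<2 * k} - I. blocking n W (Zs ! j)))"

text \<open>The degree bound is a real number, since the bounds of interest need not be integers.\<close>

definition at_least_half_property :: "nat \<Rightarrow> coalition set \<Rightarrow> real \<Rightarrow> bool" where
  "at_least_half_property n W d \<longleftrightarrow>
     (\<forall>k Zs. real k \<le> d \<and> EL_sequence n W k Zs \<longrightarrow>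
        (\<exists>i\<in>players n. length Zs \<le> 2 * card {j. j < length Zs \<and> i \<in> Zs ! j}))"

end

theory Submission
  imports Defs "Jordan_Normal_Form.Schur_Decomposition" "HOL-Analysis.Convex"
begin

text \<open>
  If every player occurs in fewer than half of the coalitions of an EL sequence, then any rough
  weights give that sequence less total weight than its winning and blocking members must have.

  Conversely, rough weights solve a homogeneous system of linear inequalities. If there are none,
  Farkas' lemma writes the vector \<open>(0, -1, \<dots>, -1)\<close> as a non-negative combination of vectors
  \<open>(1, 1\<^sub>X)\<close> for \<open>X\<close> winning, \<open>-(1, 1\<^sub>L)\<close> for \<open>L\<close> losing, and unit vectors (slacks). A basic
  solution uses the columns of an invertible integer matrix, so multiplying it by the absolute
  value of the determinant gives integers, which serve as multiplicities in an EL sequence of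
  \<open>X\<close>'s and complements of \<open>L\<close>'s. By Cramer's rule they are determinants up to sign. Subtracting half
  of row \<open>0\<close> from the other rows turns entries \<open>0, 1\<close> into \<open>-1/2, 1/2\<close>, so that a Hadamard-type
  inequality bounds each of them by \<open>2 n powr (n/2)\<close>; there are \<open>n + 1\<close> of them, and
  those of winning and losing coalitions add up to twice the degree.
\<close>

section \<open>Cone combinations and basic solutions\<close>

text \<open>Induction on the number of vectors (Bartl): if \<open>x\<close> separates \<open>b\<close> from all vectors but \<open>a m\<close>,
  apply the hypothesis to the projections along \<open>a m\<close> onto the hyperplane orthogonal to \<open>x\<close>.\<close>

lemma farkas:
  fixes a :: "'k \<Rightarrow> nat \<Rightarrow> real" and b :: "nat \<Rightarrow> real"
  assumes "finite K"
  shows "(\<exists>x. (\<forall>k\<in>K. (\<Sum>i<N. a k i * x i) \<le> 0) \<and> (\<Sum>i<N. b i * x i) > 0) \<or>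
    (\<exists>u. (\<forall>k\<in>K. 0 \<le> u k) \<and> (\<forall>i<N. b i = (\<Sum>k\<in>K. u k * a k i)))"
  using assms
proof (induction K arbitrary: a b rule: finite_induct)
  case empty
  show ?case
  proof (cases "\<forall>i<N. b i = 0")
    case False
    then obtain i where "i < N" "b i \<noteq> 0" by blast
    then have "(\<Sum>i<N. b i * b i) > 0"
      by (intro sum_pos2[where i = i]) (auto simp: zero_less_mult_iff)
    then show ?thesis by auto
  qed simp
next
  case (insert m K)
  let ?ip = "\<lambda>f x :: nat \<Rightarrow> real. \<Sum>i<N. f i * x i"
  consider x where "\<forall>k\<in>K. ?ip (a k) x \<le> 0" "?ip b x > 0"
    | u where "\<forall>k\<in>K. 0 \<le> u k" "\<forall>i<N. b i = (\<Sum>k\<in>K. u k * a k i)"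
    using insert.IH[of a b] by blast
  then show ?case
  proof cases
    case (1 x)
    show ?thesis
    proof (cases "?ip (a m) x \<le> 0")
      case True
      then show ?thesis using 1 by auto
    next
      case False
      define c where "c = ?ip (a m) x"
      have c: "c > 0" using False by (simp add: c_def)
      define p where "p = (\<lambda>f. ?ip f x / c)"
      define a' where "a' = (\<lambda>k i. a k i - p (a k) * a m i)"
      define b' where "b' = (\<lambda>i. b i - p b * a m i)"
      consider x' where "\<forall>k\<in>K. ?ip (a' k) x' \<le> 0" "?ip b' x' > 0"
        | u where "\<forall>k\<in>K. 0 \<le> u k" "\<forall>i<N. b' i = (\<Sum>k\<in>K. u k * a' k i)"
        using insert.IH[of a' b'] by blast
      then show ?thesis
      proof cases
        case x': (1 x')
        \<comment> \<open>This is the adjoint of the projection applied to \<open>x'\<close>: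
          pairing any \<open>f\<close> with \<open>x''\<close> equals pairing the projected
          \<open>f\<close> with \<open>x'\<close>. Since \<open>a m\<close> projects to 0, it is
          orthogonal to \<open>x''\<close>.\<close>
        define x'' where "x'' = (\<lambda>i. x' i - ?ip (a m) x' / c * x i)"
        have ip: "?ip f x'' = ?ip (\<lambda>i. f i - p f * a m i) x'" for f
        proof -
          have sub: "?ip f (\<lambda>i. x' i - r * x i) = ?ip f x' - r * ?ip f x" for r
            by (simp add: algebra_simps sum_subtractf sum_distrib_left)
          have "?ip f x'' = ?ip f x' - ?ip (a m) x' / c * ?ip f x"
            unfolding x''_def by (rule sub)
          also have "\<dots> = ?ip f x' - p f * ?ip (a m) x'" by (simp add: p_def)
          also have "\<dots> = ?ip (\<lambda>i. f i - p f * a m i) x'"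
            by (simp add: algebra_simps sum_subtractf sum_distrib_left)
          finally show ?thesis .
        qed
        have "p (a m) = 1" using c by (simp add: p_def c_def)
        then have "?ip (a m) x'' \<le> 0" by (simp add: ip)
        moreover have "?ip (a k) x'' \<le> 0" if "k \<in> K" for k
          using x'(1) that by (simp add: ip a'_def)
        moreover have "?ip b x'' > 0" using x'(2) by (simp add: ip b'_def)
        ultimately show ?thesis by blast
      next
        case u: (2 u)
        \<comment> \<open>Undoing the projections collects all multiples of \<open>a m\<close> in
          this one coefficient. It is non-negative because \<open>x\<close> pairs positively with
          \<open>b\<close> and non-positively with each \<open>a k\<close>.\<close>
        define v where "v = p b - (\<Sum>k\<in>K. u k * p (a k))"
        have "0 \<le> p b" using 1(2) c by (simp add: p_def)
        moreover have "(\<Sum>k\<in>K. u k * p (a k)) \<le> 0"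
          using u(1) 1(1) c by (intro sum_nonpos mult_nonneg_nonpos) (auto simp: p_def divide_nonpos_pos)
        ultimately have v: "0 \<le> v" by (simp add: v_def)
        have "b i = (\<Sum>k\<in>K. u k * a k i) + v * a m i" if "i < N" for i
        proof -
          have "b i = b' i + p b * a m i" by (simp add: b'_def)
          also have "b' i = (\<Sum>k\<in>K. u k * a' k i)" using u(2) that by blast
          also have "\<dots> = (\<Sum>k\<in>K. u k * a k i) - (\<Sum>k\<in>K. u k * p (a k)) * a m i"
            by (simp add: a'_def algebra_simps sum_subtractf sum_distrib_left)
          finally show ?thesis by (simp add: v_def algebra_simps)
        qed
        moreover have "(\<Sum>k\<in>K. (u(m := v)) k * a k i) = (\<Sum>k\<in>K. u k * a k i)" for i
          using insert.hyps by (intro sum.cong) auto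
        ultimately show ?thesis
          using insert.hyps u(1) v by (intro disjI2 exI[of _ "u(m := v)"]) auto
      qed
    qed
  next
    case (2 u)
    have "(\<Sum>k\<in>K. (u(m := 0)) k * a k i) = (\<Sum>k\<in>K. u k * a k i)" for i
      using insert.hyps by (intro sum.cong) auto
    with 2 insert.hyps show ?thesis
      by (intro disjI2 exI[of _ "u(m := 0)"]) auto
  qed
qed

text \<open>The matrix is kept as a family of columns, so that exchanging a column is the function
  update \<open>c(k := b)\<close> and membership of the columns in a set of generators is easy to
  state.\<close>

definition mat_of_col_funs :: "nat \<Rightarrow> (nat \<Rightarrow> nat \<Rightarrow> 'a) \<Rightarrow> 'a mat" where
  "mat_of_col_funs N c = mat N N (\<lambda>(i, j). c j i)"

lemma mat_of_col_funs_carrier [simp]: "mat_of_col_funs N c \<in> carrier_mat N N"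
  by (simp add: mat_of_col_funs_def)

text \<open>Cramer's rule without division. It serves twice: a pivot on a nonzero coefficient keeps
  the columns invertible, and the scaled coefficients of a basic solution are themselves
  determinants.\<close>

lemma cramer_col_funs:
  fixes c :: "nat \<Rightarrow> nat \<Rightarrow> real"
  assumes "\<And>i. i < N \<Longrightarrow> b i = (\<Sum>j<N. y j * c j i)" and "k < N"
  shows "det (mat_of_col_funs N (c(k := b))) = y k * det (mat_of_col_funs N c)"
proof -
  let ?A = "mat_of_col_funs N c"
  have "(?A *\<^sub>v vec N y) $ i = b i" if "i < N" for i
    using assms(1)[OF that] that
    by (simp add: mat_of_col_funs_def scalar_prod_def mult.commute atLeast0LessThan)
  then have "replace_col ?A (?A *\<^sub>v vec N y) k = mat_of_col_funs N (c(k := b))"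
    by (intro eq_matI) (auto simp: replace_col_def mat_of_col_funs_def)
  with cramer_lemma_mat[of ?A N "vec N y" k] assms(2) show ?thesis by simp
qed

lemma col_funs_solve:
  fixes c :: "nat \<Rightarrow> nat \<Rightarrow> real"
  assumes "det (mat_of_col_funs N c) \<noteq> 0"
  obtains z where "\<And>i. i < N \<Longrightarrow> b i = (\<Sum>j<N. z j * c j i)"
proof -
  let ?A = "mat_of_col_funs N c"
  define v where "v = (1 / det ?A) \<cdot>\<^sub>v (adj_mat ?A *\<^sub>v vec N b)"
  have adj: "adj_mat ?A \<in> carrier_mat N N" by (rule adj_mat) simp
  have v: "v \<in> carrier_vec N" using adj by (simp add: v_def carrier_vecI)
  have "?A *\<^sub>v v = (1 / det ?A) \<cdot>\<^sub>v (?A *\<^sub>v (adj_mat ?A *\<^sub>v vec N b))"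
    unfolding v_def using adj by (intro mult_mat_vec[where nr = N and nc = N]) auto
  also have "?A *\<^sub>v (adj_mat ?A *\<^sub>v vec N b) = (?A * adj_mat ?A) *\<^sub>v vec N b"
    using adj by (intro assoc_mult_mat_vec[symmetric, where ?n\<^sub>1.0 = N and ?n\<^sub>2.0 = N and ?n\<^sub>3.0 = N]) auto
  also have "?A * adj_mat ?A = det ?A \<cdot>\<^sub>m 1\<^sub>m N" by (rule adj_mat) simp
  finally have *: "?A *\<^sub>v v = vec N b" using assms by auto
  have "b i = (\<Sum>j<N. v $ j * c j i)" if "i < N" for i
  proof -
    have "b i = (?A *\<^sub>v v) $ i" using that by (simp add: *)
    also have "\<dots> = (\<Sum>j<N. v $ j * c j i)"
      using that v by (simp add: mat_of_col_funs_def scalar_prod_def mult.commute atLeast0LessThan)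
    finally show ?thesis .
  qed
  then show thesis by (rule that)
qed

text \<open>A step of the simplex method: the weight of the new column \<open>a\<close> is raised until an old weight
  reaches \<open>0\<close>, and \<open>a\<close> then replaces that column.\<close>

lemma pivot:
  fixes c :: "nat \<Rightarrow> nat \<Rightarrow> real"
  assumes det: "det (mat_of_col_funs N c) \<noteq> 0" and y: "\<And>j. j < N \<Longrightarrow> 0 \<le> y j" and t: "0 \<le> t"
  obtains c' y' where "det (mat_of_col_funs N c') \<noteq> 0" "\<And>j. j < N \<Longrightarrow> c' j \<in> insert a (c ` {..<N})"
    "\<And>j. j < N \<Longrightarrow> 0 \<le> y' j"
    "\<And>i. i < N \<Longrightarrow> (\<Sum>j<N. y' j * c' j i) = (\<Sum>j<N. y j * c j i) + t * a i"
proof -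
  obtain z where z: "\<And>i. i < N \<Longrightarrow> a i = (\<Sum>j<N. z j * c j i)"
    using col_funs_solve[OF det, where b = a] by blast
  have shift: "(\<Sum>j<N. (y j + s * z j) * c j i) = (\<Sum>j<N. y j * c j i) + s * a i" if "i < N" for s i
    using z[OF that] by (simp add: algebra_simps sum.distrib sum_distrib_left)
  \<comment> \<open>These are the weights that a full step of length \<open>t\<close> would make
    negative. If there are none, the old columns suffice.\<close>
  define J where "J = {j \<in> {..<N}. y j + t * z j < 0}"
  show thesis
  proof (cases "J = {}")
    case True
    then have "0 \<le> y j + t * z j" if "j < N" for j using that unfolding J_def by force
    then show thesis
      using det shift by (intro that[of c "\<lambda>j. y j + t * z j"]) auto
  next
    case False
    \<comment> \<open>The ratio test: \<open>r j\<close> is the step length at which weight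
      \<open>j\<close> vanishes, and the least ratio \<open>s\<close> is the longest step that keeps
      all weights non-negative.\<close>
    define r where "r = (\<lambda>j. y j / - z j)"
    have fin: "finite J" by (simp add: J_def)
    define s where "s = Min (r ` J)"
    obtain k where k: "k \<in> J" "r k = s"
      using Min_in[of "r ` J"] fin False unfolding s_def by fastforce
    have zneg: "z j < 0" if "j \<in> J" for j
    proof (rule ccontr)
      assume "\<not> z j < 0"
      then have "0 \<le> y j + t * z j" using y[of j] t that by (auto simp: J_def)
      then show False using that by (simp add: J_def)
    qed
    have kN: "k < N" and zk: "z k < 0" using k zneg by (auto simp: J_def)
    have s0: "0 \<le> s" using y[OF kN] zk k(2) by (auto simp: r_def divide_le_0_iff)
    have yk: "y k + s * z k = 0" using zk k(2) by (auto simp: r_def field_simps)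
    then have "t * z k < s * z k" using k(1) by (simp add: J_def)
    then have st: "s < t" using zk by (simp add: mult_less_cancel_right)
    have nonneg: "0 \<le> y j + s * z j" if "j < N" for j
    proof (cases "j \<in> J")
      case True
      then have "s \<le> r j" using fin by (simp add: s_def)
      with zneg[OF True] show ?thesis by (simp add: r_def field_simps)
    next
      case False
      then have "0 \<le> y j + t * z j" using that by (simp add: J_def)
      moreover have "t * z j \<le> s * z j" if "z j \<le> 0" using st that by (simp add: mult_right_mono_neg)
      moreover have "0 \<le> s * z j" if "0 \<le> z j" using s0 that by simp
      ultimately show ?thesis using y[OF \<open>j < N\<close>] by linarith
    qed
    let ?y = "\<lambda>j. if j = k then t - s else y j + s * z j"
    have "det (mat_of_col_funs N (c(k := a))) = z k * det (mat_of_col_funs N c)"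
      by (rule cramer_col_funs[OF z kN])
    then have "det (mat_of_col_funs N (c(k := a))) \<noteq> 0" using det zk by simp
    moreover have "(\<Sum>j<N. ?y j * (c(k := a)) j i) = (\<Sum>j<N. y j * c j i) + t * a i" if "i < N" for i
    proof -
      have "(\<Sum>j<N. ?y j * (c(k := a)) j i) = (t - s) * a i + (\<Sum>j\<in>{..<N} - {k}. (y j + s * z j) * c j i)"
        using kN by (subst sum.remove[of _ k]) auto
      also have "(\<Sum>j\<in>{..<N} - {k}. (y j + s * z j) * c j i) = (\<Sum>j<N. (y j + s * z j) * c j i)"
        using kN yk by (subst sum.remove[of "{..<N}" k]) auto
      finally show ?thesis unfolding shift[OF that] by (simp add: algebra_simps)
    qed
    ultimately show thesis
      using nonneg st by (intro that[of "c(k := a)" ?y]) auto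
  qed
qed

text \<open>The vectors \<open>g k\<close> enter one at a time, each by a \<open>pivot\<close>,
  starting from the basis \<open>c0\<close> with all weights 0. This is Caratheodory's theorem for
  cones, with the columns forming a basis throughout.\<close>

lemma basic_cone_solution:
  fixes g :: "'k \<Rightarrow> nat \<Rightarrow> real"
  assumes "finite K" and det: "det (mat_of_col_funs N c0) \<noteq> 0" and c0: "\<And>j. j < N \<Longrightarrow> c0 j \<in> S"
    and g: "\<And>k. k \<in> K \<Longrightarrow> g k \<in> S" and u: "\<And>k. k \<in> K \<Longrightarrow> 0 \<le> u k"
  shows "\<exists>c y. det (mat_of_col_funs N c) \<noteq> 0 \<and> (\<forall>j<N. c j \<in> S) \<and> (\<forall>j<N. 0 \<le> y j) \<and>
    (\<forall>i<N. (\<Sum>j<N. y j * c j i) = (\<Sum>k\<in>K. u k * g k i))"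
  using assms(1) g u
proof (induction K rule: finite_induct)
  case empty
  show ?case using det c0 by (intro exI[of _ c0] exI[of _ "\<lambda>_. 0"]) auto
next
  case (insert m K)
  then obtain c y where c: "det (mat_of_col_funs N c) \<noteq> 0" "\<forall>j<N. c j \<in> S" "\<forall>j<N. 0 \<le> y j"
    "\<forall>i<N. (\<Sum>j<N. y j * c j i) = (\<Sum>k\<in>K. u k * g k i)" by auto
  obtain c' y' where c': "det (mat_of_col_funs N c') \<noteq> 0" "\<And>j. j < N \<Longrightarrow> c' j \<in> insert (g m) (c ` {..<N})"
    "\<And>j. j < N \<Longrightarrow> 0 \<le> y' j"
    "\<And>i. i < N \<Longrightarrow> (\<Sum>j<N. y' j * c' j i) = (\<Sum>j<N. y j * c j i) + u m * g m i"
    using pivot[OF c(1), of y "u m" "g m"] c(3) insert.prems by auto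
  have "c' j \<in> S" if "j < N" for j
    using c'(2)[OF that] c(2) insert.prems by auto
  then show ?case using c c' insert.hyps by (intro exI[of _ c'] exI[of _ y']) auto
qed

section \<open>A Hadamard-type determinant bound\<close>

lemma prod_le_mean_power:
  fixes x :: "nat \<Rightarrow> real"
  assumes "N > 0" and "\<And>i. i < N \<Longrightarrow> 0 \<le> x i"
  shows "(\<Prod>i<N. x i) \<le> ((\<Sum>i<N. x i) / N) ^ N"
proof -
  have p: "0 \<le> (\<Prod>i<N. x i)" using assms(2) by (intro prod_nonneg) auto
  have "(\<Prod>i<N. x i) powr (1 / N) \<le> (\<Sum>i<N. x i) / N"
    using arith_geom_mean[of "{..<N}" x] assms by (auto simp: sum_divide_distrib)
  then have "((\<Prod>i<N. x i) powr (1 / N)) ^ N \<le> ((\<Sum>i<N. x i) / N) ^ N"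
    by (intro power_mono) auto
  \<comment> \<open>A zero product is treated apart, since \<open>powr_realpow\<close> needs a
    positive base.\<close>
  also have "((\<Prod>i<N. x i) powr (1 / N)) ^ N = (\<Prod>i<N. x i)"
    using p assms(1) by (cases "(\<Prod>i<N. x i) = 0")
      (simp_all add: powr_realpow[symmetric] powr_powr zero_power del: prod_zero_iff)
  finally show ?thesis .
qed

text \<open>The cyclic property of the trace, which shows that similar matrices have equal
  trace.\<close>

lemma sum_diag_mult_commute:
  fixes A :: "'a :: comm_semiring_0 mat"
  assumes "A \<in> carrier_mat n m" "B \<in> carrier_mat m n"
  shows "(\<Sum>i<n. (A * B) $$ (i, i)) = (\<Sum>i<m. (B * A) $$ (i, i))"
proof -
  have "(\<Sum>i<n. (A * B) $$ (i, i)) = (\<Sum>i<n. \<Sum>j<m. A $$ (i, j) * B $$ (j, i))"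
    using assms by (intro sum.cong) (auto simp: scalar_prod_def atLeast0LessThan)
  also have "\<dots> = (\<Sum>j<m. \<Sum>i<n. B $$ (j, i) * A $$ (i, j))"
    by (subst sum.swap) (simp add: mult.commute)
  also have "\<dots> = (\<Sum>i<m. (B * A) $$ (i, i))"
    using assms by (intro sum.cong) (auto simp: scalar_prod_def atLeast0LessThan)
  finally show ?thesis .
qed

text \<open>An eigenvector \<open>v\<close> satisfies e |v|^2 = |C v|^2, where C is \<open>A\<close>
  read as a complex matrix; conjugation passes through C because its entries are real. Complex
  numbers enter because the characteristic polynomial has to split for the Schur
  decomposition.\<close>

lemma gram_eigenvalue_nonneg:
  fixes A :: "real mat"
  assumes A: "A \<in> carrier_mat n n"
    and ev: "eigenvalue (map_mat complex_of_real (A\<^sup>T * A)) e"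
  shows "e = complex_of_real (Re e)" "0 \<le> Re e"
proof -
  let ?C = "map_mat complex_of_real A"
  have C: "?C \<in> carrier_mat n n" using A by simp
  have G: "map_mat complex_of_real (A\<^sup>T * A) = ?C\<^sup>T * ?C"
    using A by (simp add: of_real_hom.mat_hom_mult[of _ n n _ n] map_mat_transpose)
  obtain v where v: "v \<in> carrier_vec n" "v \<noteq> 0\<^sub>v n" "(?C\<^sup>T * ?C) *\<^sub>v v = e \<cdot>\<^sub>v v"
    using ev A unfolding eigenvalue_def eigenvector_def G by auto
  have Cc: "conjugate (?C *\<^sub>v v) = ?C *\<^sub>v conjugate v"
    using A v by (intro eq_vecI) (auto simp: scalar_prod_def sum_conjugate conjugate_dist_mul)
  have "e * (v \<bullet>c v) = (e \<cdot>\<^sub>v v) \<bullet>c v" using v by simp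
  also have "\<dots> = (?C\<^sup>T *\<^sub>v (?C *\<^sub>v v)) \<bullet>c v"
    using v C by (simp flip: v(3))
  also have "\<dots> = (?C *\<^sub>v v) \<bullet>c (?C *\<^sub>v v)"
    using transpose_vec_mult_scalar[OF C, of "conjugate v" "?C *\<^sub>v v"] v C by (simp add: Cc)
  finally have eq: "e * (v \<bullet>c v) = (?C *\<^sub>v v) \<bullet>c (?C *\<^sub>v v)" .
  have 1: "v \<bullet>c v > 0" using v by simp
  have 2: "(?C *\<^sub>v v) \<bullet>c (?C *\<^sub>v v) \<ge> 0" by (rule conjugate_square_ge_0_vec)
  have e: "e = ((?C *\<^sub>v v) \<bullet>c (?C *\<^sub>v v)) / (v \<bullet>c v)" using eq 1 by (auto simp: field_simps)
  have "e \<ge> 0" unfolding e using 1 2 by (auto simp: less_eq_complex_def less_complex_def Re_divide Im_divide)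
  then show "e = complex_of_real (Re e)" "0 \<le> Re e"
    by (auto simp: less_eq_complex_def complex_eq_iff)
qed

text \<open>The Gram matrix has non-negative eigenvalues with product \<open>(det A)\<^sup>2\<close> and sum the trace of the
  Gram matrix, so this is AM-GM.\<close>

lemma det_power2_le_mean_power:
  fixes A :: "real mat"
  assumes A: "A \<in> carrier_mat n n" and n: "n > 0"
  shows "(det A)\<^sup>2 \<le> ((\<Sum>j<n. \<Sum>i<n. (A $$ (i, j))\<^sup>2) / n) ^ n"
proof -
  define G where "G = map_mat complex_of_real (A\<^sup>T * A)"
  have G: "G \<in> carrier_mat n n" using A by (simp add: G_def)
  obtain es where es: "char_poly G = (\<Prod>a\<leftarrow>es. [:- a, 1:])" "length es = n"
    using char_poly_factorized[OF G] by blast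
  obtain B P Q where BPQ: "schur_decomposition G es = (B, P, Q)" by (cases "schur_decomposition G es")
  from schur_decomposition[OF G es(1) BPQ]
  have sim: "similar_mat_wit G B P Q" and ut: "upper_triangular B" and diag: "diag_mat B = es" by auto
  note w = similar_mat_witD2[OF G sim]
  define x where "x = (\<lambda>i. Re (B $$ (i, i)))"
  have Bi: "B $$ (i, i) \<in> set es" if "i < n" for i
    using diag w(5) that by (auto simp: diag_mat_def)
  have ev: "eigenvalue G e" if "e \<in> set es" for e
    using that unfolding eigenvalue_root_char_poly[OF G] es(1) by (auto simp: poly_prod_list prod_list_zero_iff)
  have x: "B $$ (i, i) = complex_of_real (x i)" "0 \<le> x i" if "i < n" for i
    using gram_eigenvalue_nonneg[OF A ev[OF Bi[OF that], unfolded G_def]] by (auto simp: x_def)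
  have "complex_of_real ((det A)\<^sup>2) = det G"
    unfolding G_def of_real_hom.hom_det using A by (simp add: det_mult[of _ n] det_transpose power2_eq_square)
  also have "\<dots> = det B" using sim by (intro det_similar) (auto simp: similar_mat_def)
  also have "\<dots> = complex_of_real (\<Prod>i<n. x i)"
    using det_upper_triangular[OF ut w(5)] w(5) x
    by (simp add: diag_mat_def prod.list_conv_set_nth atLeast0LessThan)
  finally have d: "(det A)\<^sup>2 = (\<Prod>i<n. x i)" by (simp only: of_real_eq_iff)
  have "complex_of_real (\<Sum>j<n. \<Sum>i<n. (A $$ (i, j))\<^sup>2) = (\<Sum>j<n. G $$ (j, j))"
    unfolding of_real_sum[of _ "{..<n}"] using A
    by (intro sum.cong) (auto simp: G_def scalar_prod_def power2_eq_square atLeast0LessThan)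
  also have "\<dots> = (\<Sum>j<n. (P * (B * Q)) $$ (j, j))"
    using w by (simp add: assoc_mult_mat[of _ n n _ n _ n])
  also have "\<dots> = (\<Sum>j<n. ((B * Q) * P) $$ (j, j))"
    using w by (intro sum_diag_mult_commute) auto
  also have "(B * Q) * P = B" using w by (simp add: assoc_mult_mat[of _ n n _ n _ n])
  also have "(\<Sum>j<n. B $$ (j, j)) = complex_of_real (\<Sum>i<n. x i)" by (simp add: x)
  finally have t: "(\<Sum>j<n. \<Sum>i<n. (A $$ (i, j))\<^sup>2) = (\<Sum>i<n. x i)" by (simp only: of_real_eq_iff)
  show ?thesis unfolding d t using n x(2) by (intro prod_le_mean_power) auto
qed

text \<open>Left multiplication by the unit lower triangular \<open>E\<close> subtracts half of row
  0 from every other row and keeps the determinant. A 0-1 column with leading entry 1 then has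
  entries 1/2 or -1/2 below, hence squared norm 1 + (N - 1) / 4.\<close>

lemma det_power2_le_sheared:
  fixes c :: "nat \<Rightarrow> nat \<Rightarrow> real"
  assumes "N > 0"
  shows "(det (mat_of_col_funs N c))\<^sup>2 \<le>
    ((\<Sum>j<N. \<Sum>i<N. (if i = 0 then c j 0 else c j i - c j 0 / 2)\<^sup>2) / N) ^ N"
proof -
  define E where "E = mat N N (\<lambda>(i, j). if i = j then 1 else if j = 0 then - 1 / 2 else (0 :: real))"
  have E: "E \<in> carrier_mat N N" by (simp add: E_def)
  have "det E = prod_list (diag_mat E)"
    by (rule det_lower_triangular[OF _ E]) (auto simp: E_def)
  then have detE: "det E = 1"
    by (simp add: E_def diag_mat_def prod.list_conv_set_nth)
  let ?B = "E * mat_of_col_funs N c"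
  have B: "?B \<in> carrier_mat N N" using E by simp
  have "?B $$ (i, j) = (if i = 0 then c j 0 else c j i - c j 0 / 2)" if ij: "i < N" "j < N" for i j
  proof -
    have "?B $$ (i, j) = (\<Sum>k<N. E $$ (i, k) * c j k)"
      using ij E by (auto simp: scalar_prod_def mat_of_col_funs_def atLeast0LessThan)
    also have "\<dots> = (\<Sum>k<N. (if k = i then c j k else 0) + (if k = 0 then if i = 0 then 0 else - c j k / 2 else 0))"
      using ij by (intro sum.cong) (auto simp: E_def)
    also have "\<dots> = c j i + (if i = 0 then 0 else - c j 0 / 2)"
      using ij by (simp add: sum.distrib)
    finally show ?thesis by simp
  qed
  then have "(\<Sum>j<N. \<Sum>i<N. (?B $$ (i, j))\<^sup>2) =
      (\<Sum>j<N. \<Sum>i<N. (if i = 0 then c j 0 else c j i - c j 0 / 2)\<^sup>2)"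
    by (intro sum.cong) auto
  moreover have "det ?B = det (mat_of_col_funs N c)"
    using E detE by (simp add: det_mult[of _ N])
  ultimately show ?thesis using det_power2_le_mean_power[OF B assms] by simp
qed

lemma det_Ints:
  assumes "\<And>i j. i < N \<Longrightarrow> j < N \<Longrightarrow> c j i \<in> \<int>"
  shows "det (mat_of_col_funs N c) \<in> \<int>"
proof -
  have "(\<Prod>i = 0..<N. mat_of_col_funs N c $$ (i, p i)) \<in> \<int>" if "p permutes {0..<N}" for p
    using assms permutes_in_image[OF that] by (intro Ints_prod) (auto simp: mat_of_col_funs_def)
  then show ?thesis
    by (subst det_def'[of _ N]) (auto intro!: Ints_sum Ints_mult simp: sign_def)
qed

text \<open>This is n (5/6)^(n+1) \<le> 4 without fractions. From n = 5 on the induction works,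
  since 5n + 5 \<le> 6n; the small cases are computed.\<close>

lemma mult_5_power_le: "n * 5 ^ (n + 1) \<le> (4 * 6 ^ (n + 1) :: nat)"
proof (cases "n \<le> 5")
  case True
  then have "n \<in> {0, 1, 2, 3, 4, 5}" by auto
  then show ?thesis by auto
next
  case False
  then have "5 \<le> n" by simp
  then show ?thesis
  proof (induction n rule: nat_induct_at_least)
    case (Suc n)
    have "Suc n * 5 ^ (Suc n + 1) = (5 * n + 5) * 5 ^ (n + 1)" by (simp add: algebra_simps)
    also have "\<dots> \<le> (6 * n) * 5 ^ (n + 1)" using Suc.hyps by (intro mult_right_mono) auto
    also have "\<dots> \<le> 6 * (4 * 6 ^ (n + 1))" using Suc.IH by simp
    finally show ?case by simp
  qed simp
qed

lemma mean_power_bound: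
  assumes "n > 0"
  shows "((real n * (real n / 4 + 1) + real n) / real (Suc n)) ^ Suc n \<le> 4 * real n ^ n"
proof (cases "n = 1")
  case True
  then show ?thesis by (simp add: power2_eq_square)
next
  case False
  with assms have n: "2 \<le> n" by simp
  \<comment> \<open>The factor 5/6 is attained at n = 2 and would fail at n = 1, hence the separate
    case.\<close>
  have "(real n * (real n / 4 + 1) + real n) / real (Suc n) \<le> 5 / 6 * real n"
    using n by (simp add: field_simps)
  then have "((real n * (real n / 4 + 1) + real n) / real (Suc n)) ^ Suc n \<le> (5 / 6 * real n) ^ Suc n"
    by (intro power_mono) auto
  also have "\<dots> = (real n * 5 ^ (n + 1)) / 6 ^ (n + 1) * real n ^ n"
    by (simp add: power_mult_distrib power_divide)
  also have "\<dots> \<le> 4 * real n ^ n"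
  proof (intro mult_right_mono)
    have "real (n * 5 ^ (n + 1)) \<le> real (4 * 6 ^ (n + 1))" by (rule of_nat_mono) (rule mult_5_power_le)
    then show "real n * 5 ^ (n + 1) / 6 ^ (n + 1) \<le> 4" by (simp add: field_simps)
  qed simp
  finally show ?thesis .
qed

section \<open>Rough weights as a linear system\<close>

text \<open>Coordinate \<open>0\<close> balances the numbers of winning and of losing coalitions; coordinate \<open>i \<ge> 1\<close>
  belongs to player \<open>i\<close>.\<close>

definition generators :: "nat \<Rightarrow> coalition set \<Rightarrow> (nat \<Rightarrow> real) set" where
  "generators n W =
     {\<lambda>i. of_bool (i \<in> insert 0 X) | X. winning n W X} \<union>
     {\<lambda>i. - of_bool (i \<in> insert 0 X) | X. losing n W X} \<union>
     {\<lambda>i. of_bool (i = k) | k. k \<in> players n}"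

text \<open>The entries -1 have two uses: a vector pairing positively with \<open>target\<close> has
  a nonzero player coordinate, and a combination equal to \<open>target\<close> makes every player
  occur more in losing than in winning coalitions, counted with weights.\<close>

definition target :: "nat \<Rightarrow> real" where
  "target i = (if i = 0 then 0 else - 1)"

lemma finite_generators: "finite (generators n W)"
proof -
  have "finite {X. winning n W X}" "finite {X. losing n W X}"
    by (rule finite_subset[of _ "Pow (players n)"]; auto simp: winning_def losing_def players_def)+
  then show ?thesis by (simp add: generators_def players_def)
qed

lemma sum_lessThan_Suc_players:
  fixes f :: "nat \<Rightarrow> real"
  shows "(\<Sum>i<Suc n. f i) = f 0 + (\<Sum>i\<in>players n. f i)"
  unfolding players_def sum.lessThan_Suc_shift
  by (simp add: sum.atLeast1_atMost_eq)

lemma sum_players_of_bool: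
  fixes f :: "nat \<Rightarrow> real"
  assumes "X \<subseteq> players n"
  shows "(\<Sum>i\<in>players n. of_bool (i \<in> X) * f i) = (\<Sum>i\<in>X. f i)"
proof -
  have "(\<Sum>i\<in>players n. of_bool (i \<in> X) * f i) = (\<Sum>i\<in>X. of_bool (i \<in> X) * f i)"
    using assms by (intro sum.mono_neutral_right) (auto simp: players_def)
  also have "\<dots> = (\<Sum>i\<in>X. f i)" by (intro sum.cong) auto
  finally show ?thesis .
qed

lemma not_mem_players_0: "0 \<notin> players n"
  by (simp add: players_def)

text \<open>A separating vector \<open>x\<close> from \<open>farkas\<close> would yield the weights
  \<open>- x i\<close> and the quota \<open>x 0\<close>: the coalition generators give the two
  threshold conditions, the unit vectors give non-negativity, and \<open>target\<close> excludes
  zero weights.\<close>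

lemma target_in_cone:
  assumes "\<not> roughly_weighted n W"
  obtains u where "\<forall>g\<in>generators n W. 0 \<le> u g"
    "\<forall>i<Suc n. target i = (\<Sum>g\<in>generators n W. u g * g i)"
proof -
  have False if x: "\<forall>g\<in>generators n W. (\<Sum>i<Suc n. g i * x i) \<le> 0" "(\<Sum>i<Suc n. target i * x i) > 0" for x
  proof -
    have win: "x 0 + (\<Sum>i\<in>X. x i) \<le> 0" if "winning n W X" for X
    proof -
      have "(\<lambda>i. of_bool (i \<in> insert 0 X)) \<in> generators n W" using that by (auto simp: generators_def)
      from bspec[OF x(1) this] have "(\<Sum>i<Suc n. of_bool (i \<in> insert 0 X) * x i) \<le> 0" .
      moreover have "(\<Sum>i\<in>players n. of_bool (i \<in> insert 0 X) * x i) = (\<Sum>i\<in>players n. of_bool (i \<in> X) * x i)"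
        by (intro sum.cong) (auto simp: not_mem_players_0)
      ultimately show ?thesis
        using that by (simp add: sum_lessThan_Suc_players sum_players_of_bool winning_def del: sum.lessThan_Suc)
    qed
    have lose: "0 \<le> x 0 + (\<Sum>i\<in>X. x i)" if "losing n W X" for X
    proof -
      have "(\<lambda>i. - of_bool (i \<in> insert 0 X)) \<in> generators n W" using that by (auto simp: generators_def)
      from bspec[OF x(1) this] have "(\<Sum>i<Suc n. - of_bool (i \<in> insert 0 X) * x i) \<le> 0" .
      moreover have "(\<Sum>i\<in>players n. of_bool (i \<in> insert 0 X) * x i) = (\<Sum>i\<in>players n. of_bool (i \<in> X) * x i)"
        by (intro sum.cong) (auto simp: not_mem_players_0)
      ultimately show ?thesis
        using that by (simp add: sum_lessThan_Suc_players sum_players_of_bool losing_def sum_negf del: sum.lessThan_Suc)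
    qed
    have pos: "x i \<le> 0" if "i \<in> players n" for i
    proof -
      have "(\<lambda>k. of_bool (k = i)) \<in> generators n W" using that by (auto simp: generators_def)
      from bspec[OF x(1) this] have "(\<Sum>k<Suc n. of_bool (k = i) * x k) \<le> 0" .
      moreover have "(\<Sum>k<Suc n. of_bool (k = i) * x k) = (\<Sum>k<Suc n. if k = i then x k else 0)"
        by (intro sum.cong) auto
      ultimately show ?thesis using that by (simp add: players_def del: sum.lessThan_Suc split: if_splits)
    qed
    have "(\<Sum>i\<in>players n. target i * x i) = (\<Sum>i\<in>players n. - x i)"
      by (intro sum.cong) (auto simp: target_def not_mem_players_0)
    then have "(\<Sum>i\<in>players n. x i) < 0"
      using x(2) by (simp add: sum_lessThan_Suc_players target_def sum_negf del: sum.lessThan_Suc)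
    then have "\<not> (\<forall>i\<in>players n. - x i = 0)" by (metis neg_equal_0_iff_equal order_less_irrefl sum.neutral)
    then have "roughly_weighted n W"
      unfolding roughly_weighted_def
    proof (intro exI[of _ "\<lambda>i. - x i"] exI[of _ "x 0"] conjI allI impI)
      fix X assume X: "X \<subseteq> players n"
      show "losing n W X" if "(\<Sum>i\<in>X. - x i) < x 0"
        using that X win[of X] by (auto simp: winning_def losing_def sum_negf)
      show "winning n W X" if "x 0 < (\<Sum>i\<in>X. - x i)"
        using that X lose[of X] by (auto simp: winning_def losing_def sum_negf)
    qed (use pos in auto)
    with assms show False ..
  qed
  with farkas[OF finite_generators, where N = "Suc n" and a = "\<lambda>g. g" and b = target] that show thesis by blast
qed

text \<open>Coalition generators attain the bound: 1 from coordinate 0 and 1/4 from each player.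
  Unit vectors have coordinate 0 equal to 0, so the shear fixes them and their norm is 1.\<close>

lemma generator_shear_norm:
  assumes "g \<in> generators n W"
  shows "(\<Sum>i<Suc n. (if i = 0 then g 0 else g i - g 0 / 2)\<^sup>2) \<le> n / 4 + 1"
proof -
  have "(\<Sum>i<n. (g (Suc i) - g 0 / 2)\<^sup>2) + (g 0)\<^sup>2 \<le> n / 4 + 1"
  proof -
    consider X where "g = (\<lambda>i. of_bool (i \<in> insert 0 X))" | X where "g = (\<lambda>i. - of_bool (i \<in> insert 0 X))"
      | k where "g = (\<lambda>i. of_bool (i = k))" "k \<in> players n"
      using assms unfolding generators_def by blast
    then show ?thesis
    proof cases
      case (1 X)
      have "(\<Sum>i<n. (g (Suc i) - g 0 / 2)\<^sup>2) = (\<Sum>i<n. 1 / 4)"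
        by (intro sum.cong) (auto simp: 1 power2_eq_square)
      then show ?thesis by (simp add: 1)
    next
      case (2 X)
      have "(\<Sum>i<n. (g (Suc i) - g 0 / 2)\<^sup>2) = (\<Sum>i<n. 1 / 4)"
        by (intro sum.cong) (auto simp: 2 power2_eq_square)
      then show ?thesis by (simp add: 2)
    next
      case (3 k)
      then have k: "k = Suc (k - 1)" "k - 1 < n" by (auto simp: players_def)
      have "(\<Sum>i<n. (g (Suc i) - g 0 / 2)\<^sup>2) = (\<Sum>i<n. if i = k - 1 then 1 else 0)"
        using k by (intro sum.cong) (auto simp: 3)
      then show ?thesis using k by (simp add: 3)
    qed
  qed
  then show ?thesis unfolding sum.lessThan_Suc_shift by simp
qed

text \<open>The shear fixes \<open>target\<close>, whose squared norm is n; each of the other n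
  columns contributes at most n/4 + 1.\<close>

lemma cramer_numerator_bound:
  assumes "n > 0" "k < Suc n" "\<And>j. j < Suc n \<Longrightarrow> c j \<in> generators n W"
  shows "(det (mat_of_col_funs (Suc n) (c(k := target))))\<^sup>2 \<le> 4 * real n ^ n"
proof -
  let ?s = "\<lambda>g :: nat \<Rightarrow> real. \<Sum>i<Suc n. (if i = 0 then g 0 else g i - g 0 / 2)\<^sup>2"
  have t: "?s target = n"
    unfolding sum.lessThan_Suc_shift by (simp add: target_def)
  have "(\<Sum>j<Suc n. ?s ((c(k := target)) j)) =
      ?s ((c(k := target)) k) + (\<Sum>j\<in>{..<Suc n} - {k}. ?s ((c(k := target)) j))"
    using assms(2) by (intro sum.remove) auto
  also have "\<dots> = ?s target + (\<Sum>j\<in>{..<Suc n} - {k}. ?s (c j))"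
    by (intro arg_cong2[of _ _ _ _ "(+)"] sum.cong) auto
  also have "(\<Sum>j\<in>{..<Suc n} - {k}. ?s (c j)) \<le> (\<Sum>j\<in>{..<Suc n} - {k}. n / 4 + 1)"
    using assms(3) by (intro sum_mono generator_shear_norm) auto
  also have "\<dots> = n * (n / 4 + 1)" using assms(2) by (simp add: card_Diff_singleton)
  finally have le: "(\<Sum>j<Suc n. ?s ((c(k := target)) j)) \<le> n * (n / 4 + 1) + n" using t by simp
  have "(det (mat_of_col_funs (Suc n) (c(k := target))))\<^sup>2 \<le>
      ((\<Sum>j<Suc n. ?s ((c(k := target)) j)) / Suc n) ^ Suc n"
    by (rule det_power2_le_sheared) simp
  also have "\<dots> \<le> ((n * (n / 4 + 1) + n) / Suc n) ^ Suc n"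
    using le by (intro power_mono divide_right_mono divide_nonneg_nonneg sum_nonneg) auto
  also have "\<dots> \<le> 4 * real n ^ n" by (rule mean_power_bound[OF assms(1)])
  finally show ?thesis .
qed

section \<open>EL sequences from basic solutions\<close>

text \<open>Quantifying over all \<open>P\<close> for one list lets the same list supply both its
  length and the number of occurrences of each player.\<close>

lemma list_with_multiplicities:
  fixes m :: "'i \<Rightarrow> nat" and f :: "'i \<Rightarrow> 'b"
  assumes "finite J"
  shows "\<exists>xs. set xs \<subseteq> f ` J \<and> (\<forall>P. length (filter P xs) = (\<Sum>j\<in>J. of_bool (P (f j)) * m j))"
  using assms
proof (induction J rule: finite_induct)
  case empty
  show ?case by (intro exI[of _ "[]"]) auto
next
  case (insert k J)
  then obtain xs where "set xs \<subseteq> f ` J" "\<forall>P. length (filter P xs) = (\<Sum>j\<in>J. of_bool (P (f j)) * m j)"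
    by blast
  with insert.hyps show ?case
    by (intro exI[of _ "replicate (m k) (f k) @ xs"]) (auto simp del: sum_of_bool_mult_eq)
qed

text \<open>The sequence lists the \<open>X j\<close> and then the complements of the
  \<open>L j\<close>. A player misses a complement exactly when it lies in \<open>L j\<close>; the
  count is stated as a sum on both sides to avoid subtraction on naturals.\<close>

lemma EL_sequence_from_multiplicities:
  fixes m :: "'i \<Rightarrow> nat" and X L :: "'i \<Rightarrow> coalition"
  assumes J: "finite J" "\<And>j. j \<in> J \<Longrightarrow> winning n W (X j)" "(\<Sum>j\<in>J. m j) = k"
    and K: "finite K" "\<And>j. j \<in> K \<Longrightarrow> losing n W (L j)" "(\<Sum>j\<in>K. m j) = k"
    and "1 \<le> k"
  obtains Zs where "EL_sequence n W k Zs" "length Zs = 2 * k"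
    "\<And>i. i \<in> players n \<Longrightarrow> card {j. j < length Zs \<and> i \<in> Zs ! j} + (\<Sum>j\<in>K. of_bool (i \<in> L j) * m j) =
       k + (\<Sum>j\<in>J. of_bool (i \<in> X j) * m j)"
proof -
  obtain us where us: "set us \<subseteq> X ` J"
    "\<And>P. length (filter P us) = (\<Sum>j\<in>J. of_bool (P (X j)) * m j)"
    using list_with_multiplicities[OF J(1), of X m] by blast
  obtain vs where vs: "set vs \<subseteq> (\<lambda>j. players n - L j) ` K"
    "\<And>P. length (filter P vs) = (\<Sum>j\<in>K. of_bool (P (players n - L j)) * m j)"
    using list_with_multiplicities[OF K(1), of "\<lambda>j. players n - L j" m] by blast
  have lu: "length us = k" using us(2)[of "\<lambda>_. True"] J(3) by simp
  have lv: "length vs = k" using vs(2)[of "\<lambda>_. True"] K(3) by simp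
  have "winning n W ((us @ vs) ! j)" if "j < k" for j
    using that us(1) J(2) nth_mem[of j us] by (auto simp: nth_append lu simp del: nth_mem)
  moreover have "blocking n W ((us @ vs) ! j)" if "j \<in> {..<2 * k} - {..<k}" for j
  proof -
    have "j - k < length vs" using that lv by auto
    then have "vs ! (j - k) \<in> (\<lambda>j. players n - L j) ` K" using vs(1) nth_mem by blast
    then show ?thesis using that K(2) by (auto simp: nth_append lu blocking_def)
  qed
  ultimately have "EL_sequence n W k (us @ vs)"
    unfolding EL_sequence_def using \<open>1 \<le> k\<close> lu lv
    by (intro conjI exI[of _ "{..<k}"]) auto
  moreover have "card {j. j < length (us @ vs) \<and> i \<in> (us @ vs) ! j} + (\<Sum>j\<in>K. of_bool (i \<in> L j) * m j) =
       k + (\<Sum>j\<in>J. of_bool (i \<in> X j) * m j)" if "i \<in> players n" for i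
  proof -
    have "card {j. j < length (us @ vs) \<and> i \<in> (us @ vs) ! j} = length (filter (\<lambda>Z. i \<in> Z) (us @ vs))"
      by (rule length_filter_conv_card[symmetric])
    also have "\<dots> = (\<Sum>j\<in>J. of_bool (i \<in> X j) * m j) + (\<Sum>j\<in>K. of_bool (i \<notin> L j) * m j)"
      using that by (simp add: us(2) vs(2) del: sum_of_bool_mult_eq)
    finally have "card {j. j < length (us @ vs) \<and> i \<in> (us @ vs) ! j} =
      (\<Sum>j\<in>J. of_bool (i \<in> X j) * m j) + (\<Sum>j\<in>K. of_bool (i \<notin> L j) * m j)" .
    moreover have "(\<Sum>j\<in>K. of_bool (i \<notin> L j) * m j) + (\<Sum>j\<in>K. of_bool (i \<in> L j) * m j) = k"
      unfolding sum.distrib[symmetric] K(3)[symmetric] by (intro sum.cong) auto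
    ultimately show ?thesis by simp
  qed
  ultimately show thesis using lu lv by (intro that[of "us @ vs"]) auto
qed

lemma not_roughly_weighted_multiplicities:
  assumes game: "simple_game n W" and "n > 0" and nrw: "\<not> roughly_weighted n W"
  obtains c :: "nat \<Rightarrow> nat \<Rightarrow> real" and m :: "nat \<Rightarrow> nat" and d :: real
  where "\<And>j. j < Suc n \<Longrightarrow> c j \<in> generators n W" "d > 0"
    "\<And>i. i < Suc n \<Longrightarrow> (\<Sum>j<Suc n. real (m j) * c j i) = d * target i"
    "\<And>j. j < Suc n \<Longrightarrow> (real (m j))\<^sup>2 \<le> 4 * real n ^ n"
proof -
  let ?M = "mat_of_col_funs (Suc n)"
  obtain u where u: "\<forall>g\<in>generators n W. 0 \<le> u g"
    "\<forall>i<Suc n. target i = (\<Sum>g\<in>generators n W. u g * g i)"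
    using target_in_cone[OF nrw] by blast
  have "players n \<in> W" "{} \<notin> W"
    using game unfolding simple_game_def by blast+
  then have empty: "losing n W {}" by (simp add: losing_def)
  \<comment> \<open>The starting basis is diagonal: the losing empty coalition gives the negated
    unit vector of coordinate 0, and the slacks give the rest.\<close>
  define c0 :: "nat \<Rightarrow> nat \<Rightarrow> real" where
    "c0 = (\<lambda>j i. if j = 0 then - of_bool (i \<in> insert 0 {}) else of_bool (i = j))"
  have "c0 j \<in> generators n W" if "j < Suc n" for j
    using that empty by (cases "j = 0") (force simp: c0_def generators_def players_def)+
  moreover have "det (?M c0) = prod_list (diag_mat (?M c0))"
    by (rule det_lower_triangular[of "Suc n"]) (auto simp: mat_of_col_funs_def c0_def)
  then have "det (?M c0) \<noteq> 0"
    by (auto simp: prod_list_zero_iff diag_mat_def mat_of_col_funs_def c0_def)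
  ultimately obtain c y where c: "det (?M c) \<noteq> 0" "\<And>j. j < Suc n \<Longrightarrow> c j \<in> generators n W"
    and y: "\<And>j. j < Suc n \<Longrightarrow> 0 \<le> y j"
      "\<And>i. i < Suc n \<Longrightarrow> (\<Sum>j<Suc n. y j * c j i) = (\<Sum>g\<in>generators n W. u g * g i)"
    using basic_cone_solution[OF finite_generators[of n W], where N = "Suc n" and ?c0.0 = c0 and S = "generators n W" and g = "\<lambda>g. g" and u = u] u(1)
    by blast
  \<comment> \<open>The determinant clears all denominators by Cramer's rule; the absolute value
    keeps the multiplicities non-negative.\<close>
  define d where "d = \<bar>det (?M c)\<bar>"
  have cramer: "det (?M (c(j := target))) = y j * det (?M c)" if "j < Suc n" for j
    using u(2) y(2) that by (intro cramer_col_funs) auto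
  have "\<exists>k :: nat. real k = d * y j" if "j < Suc n" for j
  proof -
    have "(c(j := target)) l i \<in> \<int>" if "l < Suc n" for l i
      using c(2)[OF that] by (auto simp: generators_def target_def)
    then have "y j * det (?M c) \<in> \<int>"
      unfolding cramer[OF that, symmetric] by (intro det_Ints) auto
    then have "d * y j \<in> \<int>" by (auto simp: d_def abs_if mult.commute)
    moreover have "0 \<le> d * y j" using y(1)[OF that] by (simp add: d_def)
    ultimately have "d * y j \<in> \<nat>" by (simp add: Nats_altdef2)
    then show ?thesis by (auto simp: Nats_def)
  qed
  then obtain m :: "nat \<Rightarrow> nat" where m: "\<And>j. j < Suc n \<Longrightarrow> real (m j) = d * y j" by metis
  show thesis
  proof (rule that[OF c(2)])
    show "d > 0" using c(1) by (simp add: d_def)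
    show "(\<Sum>j<Suc n. real (m j) * c j i) = d * target i" if "i < Suc n" for i
    proof -
      have "(\<Sum>j<Suc n. real (m j) * c j i) = (\<Sum>j<Suc n. d * (y j * c j i))"
        by (intro sum.cong) (auto simp: m)
      also have "\<dots> = d * target i"
        unfolding sum_distrib_left[symmetric] using y(2)[OF that] u(2) that by simp
      finally show ?thesis .
    qed
    show "(real (m j))\<^sup>2 \<le> 4 * real n ^ n" if "j < Suc n" for j
    proof -
      have "(real (m j))\<^sup>2 = (det (?M (c(j := target))))\<^sup>2"
        by (simp add: m[OF that] cramer[OF that] d_def power_mult_distrib mult.commute)
      then show ?thesis using cramer_numerator_bound[OF \<open>n > 0\<close> that c(2)] by simp
    qed
  qed
qed

lemma not_roughly_weighted_imp_EL_sequence: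
  assumes game: "simple_game n W" and n: "n > 0" and nrw: "\<not> roughly_weighted n W"
  obtains k Zs where "real k \<le> (real n + 1) * real n powr (real n / 2)" "EL_sequence n W k Zs"
    "\<And>i. i \<in> players n \<Longrightarrow> 2 * card {j. j < length Zs \<and> i \<in> Zs ! j} < length Zs"
proof -
  obtain c m d where c: "\<And>j. j < Suc n \<Longrightarrow> c j \<in> generators n W" and d: "d > 0"
    and sum: "\<And>i. i < Suc n \<Longrightarrow> (\<Sum>j<Suc n. real (m j) * c j i) = d * target i"
    and m: "\<And>j. j < Suc n \<Longrightarrow> (real (m j))\<^sup>2 \<le> 4 * real n ^ n"
    by (rule not_roughly_weighted_multiplicities[OF game n nrw]) (rule that)
  define J where "J = {j \<in> {..<Suc n}. \<exists>X. winning n W X \<and> c j = (\<lambda>i. of_bool (i \<in> insert 0 X))}"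
  define K where "K = {j \<in> {..<Suc n}. \<exists>X. losing n W X \<and> c j = (\<lambda>i. - of_bool (i \<in> insert 0 X))}"
  define R where "R = {..<Suc n} - (J \<union> K)"
  have R: "\<exists>k. k \<in> players n \<and> c j = (\<lambda>i. of_bool (i = k))" if "j \<in> R" for j
    using c[of j] that unfolding generators_def R_def J_def K_def by blast
  define X where "X = (\<lambda>j. SOME Y. winning n W Y \<and> c j = (\<lambda>i. of_bool (i \<in> insert 0 Y)))"
  have X: "winning n W (X j)" "c j = (\<lambda>i. of_bool (i \<in> insert 0 (X j)))" if "j \<in> J" for j
  proof -
    have "\<exists>Y. winning n W Y \<and> c j = (\<lambda>i. of_bool (i \<in> insert 0 Y))"
      using that unfolding J_def by blast
    from someI_ex[OF this] show "winning n W (X j)" "c j = (\<lambda>i. of_bool (i \<in> insert 0 (X j)))"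
      unfolding X_def by blast+
  qed
  define L where "L = (\<lambda>j. SOME Y. losing n W Y \<and> c j = (\<lambda>i. - of_bool (i \<in> insert 0 Y)))"
  have L: "losing n W (L j)" "c j = (\<lambda>i. - of_bool (i \<in> insert 0 (L j)))" if "j \<in> K" for j
  proof -
    have "\<exists>Y. losing n W Y \<and> c j = (\<lambda>i. - of_bool (i \<in> insert 0 Y))"
      using that unfolding K_def by blast
    from someI_ex[OF this] show "losing n W (L j)" "c j = (\<lambda>i. - of_bool (i \<in> insert 0 (L j)))"
      unfolding L_def by blast+
  qed
  have fin: "finite J" "finite K" "finite R" by (auto simp: J_def K_def R_def)
  have "c j 0 = 1" if "j \<in> J" for j using X(2)[OF that] by simp
  moreover have "c j 0 = - 1" if "j \<in> K" for j using L(2)[OF that] by simp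
  ultimately have disj: "J \<inter> K = {}" by fastforce
  have un: "{..<Suc n} = J \<union> K \<union> R" by (auto simp: J_def K_def R_def)
  have split: "(\<Sum>j<Suc n. f j) = (\<Sum>j\<in>J. f j) + (\<Sum>j\<in>K. f j) + (\<Sum>j\<in>R. f j)" for f :: "nat \<Rightarrow> real"
    unfolding un using fin disj by (subst sum.union_disjoint | simp add: R_def | blast)+
  define k where "k = (\<Sum>j\<in>J. m j)"
  \<comment> \<open>Row 0: slacks and \<open>target\<close> vanish there, so the winning and the
    losing multiplicities have the same total \<open>k\<close>.\<close>
  have "(\<Sum>j\<in>R. real (m j) * c j 0) = 0"
  proof (rule sum.neutral, rule ballI)
    fix j assume "j \<in> R"
    from R[OF this] show "real (m j) * c j 0 = 0" by (auto simp: not_mem_players_0)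
  qed
  moreover have "(\<Sum>j\<in>J. real (m j) * c j 0) = real (\<Sum>j\<in>J. m j)"
    unfolding of_nat_sum using X(2) by (intro sum.cong) auto
  moreover have "(\<Sum>j\<in>K. real (m j) * c j 0) = - real (\<Sum>j\<in>K. m j)"
    unfolding of_nat_sum sum_negf[symmetric] using L(2) by (intro sum.cong) auto
  ultimately have "real (\<Sum>j\<in>J. m j) - real (\<Sum>j\<in>K. m j) = 0"
    using sum[of 0] unfolding split by (simp add: target_def)
  then have kK: "(\<Sum>j\<in>K. m j) = k" by (simp add: k_def del: of_nat_sum)
  \<comment> \<open>Row \<open>i\<close>: winning occurrences minus losing ones plus a non-negative
    slack equal \<open>- d\<close>, which is negative.\<close>
  have less: "(\<Sum>j\<in>J. of_bool (i \<in> X j) * m j) < (\<Sum>j\<in>K. of_bool (i \<in> L j) * m j)" if "i \<in> players n" for i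
  proof -
    have i: "i < Suc n" "i \<noteq> 0" using that by (auto simp: players_def)
    have "0 \<le> (\<Sum>j\<in>R. real (m j) * c j i)"
      using R by (intro sum_nonneg mult_nonneg_nonneg) force+
    moreover have "(\<Sum>j\<in>J. real (m j) * c j i) = real (\<Sum>j\<in>J. of_bool (i \<in> X j) * m j)"
      unfolding of_nat_sum using X(2) i by (intro sum.cong) auto
    moreover have "(\<Sum>j\<in>K. real (m j) * c j i) = - real (\<Sum>j\<in>K. of_bool (i \<in> L j) * m j)"
      unfolding of_nat_sum sum_negf[symmetric] using L(2) i by (intro sum.cong) auto
    ultimately have "real (\<Sum>j\<in>J. of_bool (i \<in> X j) * m j) - real (\<Sum>j\<in>K. of_bool (i \<in> L j) * m j) \<le> - d"
      using sum[OF i(1)] i(2) unfolding split by (simp add: target_def)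
    then show ?thesis using d by linarith
  qed
  have "1 \<le> k"
  \<comment> \<open>With \<open>k = 0\<close> all losing multiplicities vanish, against the strict
    inequality for player 1.\<close>
  proof (rule ccontr)
    assume "\<not> 1 \<le> k"
    then have "(\<Sum>j\<in>K. m j) = 0" using kK by linarith
    then have "\<forall>j\<in>K. m j = 0" using fin by simp
    then have "(\<Sum>j\<in>K. of_bool (1 \<in> L j) * m j) = 0" by (intro sum.neutral) auto
    then show False using less[of 1] n by (simp add: players_def)
  qed
  then obtain Zs where Zs: "EL_sequence n W k Zs" "length Zs = 2 * k"
    "\<And>i. i \<in> players n \<Longrightarrow> card {j. j < length Zs \<and> i \<in> Zs ! j} + (\<Sum>j\<in>K. of_bool (i \<in> L j) * m j) =
       k + (\<Sum>j\<in>J. of_bool (i \<in> X j) * m j)"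
    using EL_sequence_from_multiplicities[where X = X and L = L and W = W,
        OF fin(1) _ k_def[symmetric] fin(2) _ kK] X(1) L(1) by blast
  have "real (m j) \<le> 2 * real n powr (real n / 2)" if "j < Suc n" for j
  proof (rule power2_le_imp_le)
    have "(real n powr (real n / 2))\<^sup>2 = real n ^ n"
      using n by (simp add: power2_eq_square powr_realpow flip: powr_add)
    then show "(real (m j))\<^sup>2 \<le> (2 * real n powr (real n / 2))\<^sup>2"
      using m[OF that] by (simp add: power_mult_distrib)
  qed simp
  \<comment> \<open>The n + 1 multiplicities together are at least 2k, so the factor 2 in their
    bound cancels.\<close>
  then have "(\<Sum>j<Suc n. real (m j)) \<le> (\<Sum>j<Suc n. 2 * real n powr (real n / 2))"
    by (intro sum_mono) auto
  moreover have "2 * real k \<le> (\<Sum>j<Suc n. real (m j))"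
    unfolding split using kK by (simp add: k_def flip: of_nat_sum)
  ultimately have "real k \<le> (real n + 1) * real n powr (real n / 2)"
    by (simp add: algebra_simps)
  then show thesis
    using Zs(1)
  proof (rule that)
    fix i assume "i \<in> players n"
    from Zs(3)[OF this] less[OF this] show "2 * card {j. j < length Zs \<and> i \<in> Zs ! j} < length Zs"
      unfolding Zs(2) by linarith
  qed
qed

section \<open>Weight counting along an EL sequence\<close>

lemma roughly_weighted_imp_frequent_player:
  assumes game: "simple_game n W" and rw: "roughly_weighted n W" and EL: "EL_sequence n W k Zs"
  shows "\<exists>i\<in>players n. length Zs \<le> 2 * card {j. j < length Zs \<and> i \<in> Zs ! j}"
proof (rule ccontr)
  assume neg: "\<not> ?thesis"
  define cnt where "cnt = (\<lambda>i. card {j. j < length Zs \<and> i \<in> Zs ! j})"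
  obtain w :: "nat \<Rightarrow> real" and q :: real where w: "\<forall>i\<in>players n. 0 \<le> w i" "\<not> ((\<forall>i\<in>players n. w i = 0) \<and> q = 0)"
    and rough: "\<And>X. X \<subseteq> players n \<Longrightarrow> (\<Sum>i\<in>X. w i) < q \<Longrightarrow> losing n W X"
      "\<And>X. X \<subseteq> players n \<Longrightarrow> (\<Sum>i\<in>X. w i) > q \<Longrightarrow> winning n W X"
    using rw unfolding roughly_weighted_def by blast
  obtain I where I: "1 \<le> k" "length Zs = 2 * k" "I \<subseteq> {..<2 * k}" "card I = k"
    "\<And>j. j \<in> I \<Longrightarrow> winning n W (Zs ! j)" "\<And>j. j \<in> {..<2 * k} - I \<Longrightarrow> blocking n W (Zs ! j)"
    using EL unfolding EL_sequence_def by blast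
  have fin: "finite (players n)" by (simp add: players_def)
  have P: "players n \<in> W" "{} \<notin> W" using game unfolding simple_game_def by blast+
  let ?w = "\<lambda>X. \<Sum>i\<in>X. w i"
  have win: "q \<le> ?w X" if "winning n W X" for X
    using rough(1)[of X] that by (force simp: winning_def losing_def)
  have lose: "?w X \<le> q" if "losing n W X" for X
    using rough(2)[of X] that by (force simp: winning_def losing_def)
  have block: "?w (players n) - q \<le> ?w X" if "blocking n W X" for X
  proof -
    obtain Y where Y: "losing n W Y" "X = players n - Y" using \<open>blocking n W X\<close> by (auto simp: blocking_def)
    then have "?w X = ?w (players n) - ?w Y" using fin by (simp add: losing_def sum_diff)
    then show ?thesis using lose[OF Y(1)] by simp
  qed
  have sub: "Zs ! j \<subseteq> players n" if "j < 2 * k" for j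
    using I(5)[of j] I(6)[of j] that by (cases "j \<in> I") (auto simp: winning_def blocking_def)
  \<comment> \<open>The k winning members weigh at least \<open>q\<close> each and the k blocking
    ones at least the total weight minus \<open>q\<close>, so \<open>q\<close> cancels. The sum is
    then recounted by players.\<close>
  have "real k * ?w (players n) = (\<Sum>j\<in>I. q) + (\<Sum>j\<in>{..<2 * k} - I. ?w (players n) - q)"
    using I(3,4) finite_subset[OF I(3)] by (simp add: card_Diff_subset algebra_simps)
  also have "\<dots> \<le> (\<Sum>j\<in>I. ?w (Zs ! j)) + (\<Sum>j\<in>{..<2 * k} - I. ?w (Zs ! j))"
    using I(5,6) win block by (intro add_mono sum_mono) auto
  also have "\<dots> = (\<Sum>j<2 * k. ?w (Zs ! j))"
    using I(3) by (simp add: sum.subset_diff[of I "{..<2 * k}"])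
  also have "\<dots> = (\<Sum>j<2 * k. \<Sum>i\<in>players n. of_bool (i \<in> Zs ! j) * w i)"
    by (intro sum.cong refl sum_players_of_bool[symmetric] sub) auto
  also have "\<dots> = (\<Sum>i\<in>players n. (\<Sum>j<2 * k. of_bool (i \<in> Zs ! j)) * w i)"
    by (subst sum.swap) (simp add: sum_distrib_right)
  also have "\<dots> = (\<Sum>i\<in>players n. real (cnt i) * w i)"
  proof (intro sum.cong refl)
    fix i
    have "(\<Sum>j<2 * k. of_bool (i \<in> Zs ! j) :: real) = real (card ({..<2 * k} \<inter> {j. i \<in> Zs ! j}))"
      by (simp add: of_bool_def sum.If_cases)
    also have "{..<2 * k} \<inter> {j. i \<in> Zs ! j} = {j. j < length Zs \<and> i \<in> Zs ! j}" using I(2) by auto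
    finally show "(\<Sum>j<2 * k. of_bool (i \<in> Zs ! j)) * w i = real (cnt i) * w i" by (simp add: cnt_def)
  qed
  finally have le: "(\<Sum>i\<in>players n. real k * w i) \<le> (\<Sum>i\<in>players n. real (cnt i) * w i)"
    by (simp add: sum_distrib_left)
  have cnt: "cnt i < k" if "i \<in> players n" for i
    using neg that I(2) by (auto simp: cnt_def)
  \<comment> \<open>Every player occurs fewer than \<open>k\<close> times, so a single positive
    weight would make the reverse inequality strict.\<close>
  have zero: "w i = 0" if "i \<in> players n" for i
  proof (rule ccontr)
    assume "w i \<noteq> 0"
    then have "(\<Sum>i\<in>players n. real (cnt i) * w i) < (\<Sum>i\<in>players n. real k * w i)"
      using w(1) cnt that fin
      by (intro sum_strict_mono_ex1) (auto intro!: mult_right_mono mult_strict_right_mono bexI[of _ i] simp: less_imp_le order_less_le)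
    with le show False by simp
  qed
  \<comment> \<open>With zero weights, the winning grand coalition forces \<open>q\<close> \<le> 0
    and the losing empty one 0 \<le> \<open>q\<close>, so weights and quota would all be
    zero.\<close>
  then have "?w (players n) = 0" by simp
  moreover have "q \<le> ?w (players n)" using P by (intro win) (simp add: winning_def)
  moreover have "0 \<le> q" using lose[of "{}"] P by (simp add: losing_def)
  ultimately show False using w(2) zero by auto
qed

theorem theorem9:
  fixes n :: nat and W :: "nat set set"
  assumes "simple_game n W"
  shows "roughly_weighted n W \<longleftrightarrow>
    at_least_half_property n W ((real n + 1) * 2 powr (1 / 2 * real n * log 2 (real n)))"
proof
  assume "roughly_weighted n W"
  then show "at_least_half_property n W ((real n + 1) * 2 powr (1 / 2 * real n * log 2 (real n)))"
    using roughly_weighted_imp_frequent_player[OF assms] by (auto simp: at_least_half_property_def)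
next
  assume half: "at_least_half_property n W ((real n + 1) * 2 powr (1 / 2 * real n * log 2 (real n)))"
  \<comment> \<open>Without players the empty coalition is the only one, and a nonempty
    \<open>W\<close> would contain every coalition.\<close>
  have "n \<noteq> 0"
  proof
    assume "n = 0"
    then have "W \<subseteq> {{}}" "W \<noteq> {}" "W \<noteq> {{}}" using assms by (auto simp: simple_game_def players_def)
    then show False by blast
  qed
  then have n: "n > 0" by simp
  have "2 powr (1 / 2 * real n * log 2 (real n)) = (2 powr log 2 (real n)) powr (real n / 2)"
    by (simp add: powr_powr mult.commute)
  also have "\<dots> = real n powr (real n / 2)" using n by simp
  finally have bound: "2 powr (1 / 2 * real n * log 2 (real n)) = real n powr (real n / 2)" .
  show "roughly_weighted n W"
  proof (rule ccontr)
    assume "\<not> roughly_weighted n W"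
    from not_roughly_weighted_imp_EL_sequence[OF assms n this] obtain k Zs
      where "real k \<le> (real n + 1) * real n powr (real n / 2)" "EL_sequence n W k Zs"
        and few: "\<And>i. i \<in> players n \<Longrightarrow> 2 * card {j. j < length Zs \<and> i \<in> Zs ! j} < length Zs"
      by metis
    with half bound obtain i where "i \<in> players n" "length Zs \<le> 2 * card {j. j < length Zs \<and> i \<in> Zs ! j}"
      unfolding at_least_half_property_def by metis
    with few[of i] show False by simp
  qed
qed

end
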